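(* Let $B_n$ denote the $n$-th Bernoulli number. The sequence $\{\sqrt[n]{|B_{2n}|}\}_{n\geq 1}$ is strictly increasing; that is, $\sqrt[n]{|B_{2n}|}<\sqrt[n+1]{|B_{2n+2}|}$ for all integers $n\geq 1$.
   Context: The Bernoulli numbers are the usual ones, so that $|B_{2n}|=\frac{2(2n)!}{(2\pi)^{2n}}\zeta(2n)$ for $n\ge 1$, where $\zeta$ is the Riemann zeta function. *)

theory Defs
  imports Complex_Main "HOL-Computational_Algebra.Formal_Power_Series"
begin

text \<open>
  Bernoulli numbers via the exponential generating function
  \<open>x / (e\<^sup>x - 1) = (\<Sum>n. B\<^sub>n x\<^sup>n / n!)\<close>; in particular \<open>B\<^sub>1 = -1/2\<close>.
\<close>

definition bernoulli :: "nat \<Rightarrow> real" where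
  "bernoulli n = fact n * fps_nth (fps_X / (fps_exp 1 - 1)) n"

text \<open>The division of formal power series above is exact.\<close>

lemma bernoulli_egf:
  "Abs_fps (\<lambda>n. bernoulli n / fact n) * (fps_exp 1 - 1) = fps_X"
proof -
  have ne: "fps_exp (1::real) - 1 \<noteq> 0"
  proof
    assume "fps_exp (1::real) - 1 = 0"
    then have "fps_nth (fps_exp (1::real) - 1) 1 = 0" by simp
    then show False by simp
  qed
  have "subdegree (fps_exp (1::real) - 1) = 1"
    by (rule subdegreeI) auto
  then have dvd: "fps_exp (1::real) - 1 dvd fps_X"
    using ne by (simp add: fps_dvd_iff)
  have "Abs_fps (\<lambda>n. bernoulli n / fact n) = fps_X / (fps_exp 1 - 1)"
    by (simp add: bernoulli_def fps_eq_iff)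
  then show ?thesis
    using dvd by simp
qed

lemma bernoulli_recurrence:
  "(\<Sum>k\<le>n. real (Suc n choose k) * bernoulli k) = (if n = 0 then 1 else 0)"
proof -
  have "(\<Sum>k\<le>n. real (Suc n choose k) * bernoulli k) =
        fact (Suc n) * (\<Sum>k\<le>n. bernoulli k / fact k * (1 / fact (Suc n - k)))"
    unfolding sum_distrib_left
    by (rule sum.cong) (auto simp: binomial_fact field_simps)
  also have "(\<Sum>k\<le>n. bernoulli k / fact k * (1 / fact (Suc n - k))) =
        fps_nth (Abs_fps (\<lambda>n. bernoulli n / fact n) * (fps_exp 1 - 1)) (Suc n)"
    by (simp add: fps_mult_nth atLeast0AtMost) (simp add: mult.commute)
  also have "\<dots> = (if n = 0 then 1 else 0)"
    by (simp add: bernoulli_egf)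
  finally show ?thesis by simp
qed

lemma bernoulli_small:
  "bernoulli 0 = 1" "bernoulli 1 = -1/2" "bernoulli 2 = 1/6"
proof -
  show 0: "bernoulli 0 = 1"
    using bernoulli_recurrence[of 0] by simp
  show 1: "bernoulli 1 = -1/2"
    using bernoulli_recurrence[of 1] 0 by simp
  show "bernoulli 2 = 1/6"
    using bernoulli_recurrence[of 2] 0 1 by (simp add: numeral_2_eq_2 numeral_3_eq_3)
qed

end

theory Submission
  imports Defs "HOL-Analysis.Gamma_Function" "HOL-Analysis.FPS_Convergence"
begin

text \<open>
  Write \<open>b n = \<bar>B\<^bsub>2n\<^esub>\<bar>\<close>. If a positive sequence satisfies
  \<open>b (n + 1)\<^sup>2 \<le> b n * b (n + 2)\<close> for \<open>n \<ge> 1\<close>, then \<open>ln \<circ> b\<close> is convex, and the secant slopes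
  \<open>ln (b n) / n\<close> through the origin increase as soon as the first of them is smaller than the second, that is, as soon as
  \<open>b 1\<^sup>2 < b 2\<close> (lemma \<open>root_less_root_Suc_of_log_convex\<close>). For the Bernoulli numbers
  this initial condition is \<open>1/36 < 1/30\<close>.

  Log-convexity comes from Euler's formula
  \<open>b n = 2 (2n)! / (2 \<pi>)\<^bsup>2n\<^esup> * \<zeta>(2n)\<close> (lemma \<open>abs_bernoulli_even_eq_zeta\<close>).
  The powers of \<open>2 \<pi>\<close> form a geometric sequence, the factorials \<open>(2n)!\<close> are log-convex, and
  \<open>\<zeta>(s + 2)\<^sup>2 \<le> \<zeta>(s) * \<zeta>(s + 4)\<close> is the Cauchy-Schwarz inequality for
  \<open>\<Sum>k. k\<^bsup>-s/2\<^esup> * k\<^bsup>-s/2 - 2\<^esup>\<close> (lemma \<open>zeta_nat_log_convex\<close>).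

  Euler's formula is obtained by computing the power series of \<open>\<pi> x cot (\<pi> x)\<close> in two ways.
  Taking logarithms in the product formula for the sine and expanding each
  \<open>ln (1 - x\<^sup>2 / k\<^sup>2)\<close> gives \<open>- ln (sin (\<pi> x) / (\<pi> x)) = \<Sum>n\<ge>1. \<zeta>(2n) / n * x\<^bsup>2n\<^esup>\<close>,
  whose derivative yields \<open>\<pi> x cot (\<pi> x) = 1 - 2 (\<Sum>n\<ge>1. \<zeta>(2n) * x\<^bsup>2n\<^esup>)\<close>
  (lemma \<open>cot_zeta_fps\<close>). Substituting \<open>2 \<pi> \<i> x\<close> into the generating function of the
  Bernoulli numbers gives the same function, up to the linear term \<open>\<pi> \<i> x\<close>
  (lemma \<open>cot_bernoulli_fps\<close>). Both identities are stated after multiplication by the sine,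
  so that they are equations between formal power series without division.
\<close>

section \<open>Two facts about series\<close>

text \<open>
  Uniqueness of power series coefficients, needed over the reals. Dividing a nonzero \<open>f\<close> by
  \<open>x ^ d\<close> with \<open>d\<close> the order of its zero leaves a continuous function with a nonzero value at
  \<open>0\<close>, which therefore cannot vanish at all points near \<open>0\<close>.
\<close>

lemma eval_fps_eq_0_imp_eq_0:
  fixes f :: "'a :: {banach, real_normed_field} fps"
  assumes conv: "fps_conv_radius f > 0" and ev: "\<forall>\<^sub>F x in at 0. eval_fps f x = 0"
  shows "f = 0"
proof (rule ccontr)
  assume "f \<noteq> 0"
  define d where "d = subdegree f"
  define g where "g = fps_shift d f"
  have g: "eval_fps g x = (if x = 0 then fps_nth f d else eval_fps f x / x ^ d)"
    if "ereal (norm x) < fps_conv_radius f" for x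
    using eval_fps_shift[of d f x] that by (simp add: g_def d_def)
  have "isCont (eval_fps g) 0"
    using conv by (intro continuous_eval_fps) (auto simp: g_def zero_ereal_def)
  then have lim: "eval_fps g \<midarrow>0\<rightarrow> eval_fps g 0"
    by (simp add: isCont_def)
  have "eventually (\<lambda>x. x \<in> eball 0 (fps_conv_radius f) - {0}) (at 0)"
    using conv by (intro eventually_at_in_open) (auto simp: zero_ereal_def)
  with ev have "\<forall>\<^sub>F x in at 0. eval_fps g x = 0"
    by eventually_elim (use g in auto)
  then have "eval_fps g \<midarrow>0\<rightarrow> 0"
    by (rule tendsto_eventually)
  with lim have "eval_fps g 0 = 0"
    by (rule LIM_unique)
  with g[of 0] conv have "fps_nth f d = 0"
    by (simp add: zero_ereal_def)
  with \<open>f \<noteq> 0\<close> show False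
    by (simp add: d_def nth_subdegree_nonzero)
qed

text \<open>
  Tonelli's theorem for double series: for nonnegative terms, convergence of the iterated sum by rows
  already gives unconditional summability over all pairs of indices.
\<close>

lemma sums_swap_nonneg:
  fixes t :: "nat \<Rightarrow> nat \<Rightarrow> real"
  assumes nonneg: "\<And>k n. t k n \<ge> 0"
    and rows: "\<And>k. t k sums r k" and total: "r sums S"
    and cols: "\<And>n. (\<lambda>k. t k n) sums c n"
  shows "c sums S"
proof -
  have r_nonneg: "r k \<ge> 0" for k
    by (rule sums_le[OF _ sums_zero rows]) (rule nonneg)
  have rows': "(t k has_sum r k) UNIV" for k
    by (intro sums_nonneg_imp_has_sum rows nonneg)
  have cols': "((\<lambda>k. t k n) has_sum c n) UNIV" for n
    by (intro sums_nonneg_imp_has_sum cols nonneg)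
  have total': "(r has_sum S) UNIV"
    by (intro sums_nonneg_imp_has_sum total r_nonneg)
  have "(\<lambda>(k, n). t k n) abs_summable_on UNIV \<times> UNIV"
    unfolding abs_summable_on_Sigma_iff
    using nonneg r_nonneg infsumI[OF rows'] has_sum_imp_summable[OF rows']
      has_sum_imp_summable[OF total'] by simp
  then have "(\<lambda>(k, n). t k n) summable_on UNIV \<times> UNIV"
    by (rule abs_summable_summable)
  then have "((\<lambda>(k, n). t k n) has_sum S) (UNIV \<times> UNIV)"
    using rows' total' by (intro has_sum_SigmaI[where g = r]) auto
  then have "((\<lambda>(n, k). t k n) has_sum S) (UNIV \<times> UNIV)"
    by (subst has_sum_reindex_bij_witness[of _ prod.swap prod.swap _ "\<lambda>(k, n). t k n"]) auto
  then have "(c has_sum S) UNIV"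
    by (rule has_sum_SigmaD) (use cols' in auto)
  then show ?thesis
    by (rule has_sum_imp_sums)
qed

section \<open>Zeta values and their log-convexity\<close>

definition zeta_nat :: "nat \<Rightarrow> real" where
  "zeta_nat s = (\<Sum>k. 1 / real (Suc k) ^ s)"

lemma zeta_nat_sums:
  assumes "s \<ge> 2"
  shows "(\<lambda>k. 1 / real (Suc k) ^ s) sums zeta_nat s"
proof -
  have "summable (\<lambda>k. inverse (real (Suc k) ^ s))"
    using inverse_power_summable[OF assms, where 'a = real] by (subst summable_Suc_iff)
  then show ?thesis
    by (simp add: zeta_nat_def inverse_eq_divide summable_sums)
qed

lemma zeta_nat_pos: "s \<ge> 2 \<Longrightarrow> zeta_nat s > 0"
  unfolding zeta_nat_def using zeta_nat_sums[of s]
  by (intro suminf_pos) (auto simp: sums_iff)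

text \<open>
  With \<open>a\<close>, \<open>b\<close>, \<open>c\<close> the three values in question, the series
  \<open>\<Sum>k. (a / k\<^sup>2 - b)\<^sup>2 / k ^ s\<close> has nonnegative terms and sum \<open>a * (a * c - b\<^sup>2)\<close>. This is
  the usual proof of the Cauchy-Schwarz inequality.
\<close>

lemma zeta_nat_log_convex:
  assumes "s \<ge> 2"
  shows "zeta_nat (s + 2) ^ 2 \<le> zeta_nat s * zeta_nat (s + 4)"
proof -
  define a b c where "a = zeta_nat s" and "b = zeta_nat (s + 2)" and "c = zeta_nat (s + 4)"
  have "(\<lambda>k. a\<^sup>2 * (1 / real (Suc k) ^ (s + 4)) - 2 * a * b * (1 / real (Suc k) ^ (s + 2))
             + b\<^sup>2 * (1 / real (Suc k) ^ s)) sums (a\<^sup>2 * c - 2 * a * b * b + b\<^sup>2 * a)"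
    unfolding a_def b_def c_def
    using assms by (intro sums_add sums_diff sums_mult zeta_nat_sums) auto
  also have "(\<lambda>k. a\<^sup>2 * (1 / real (Suc k) ^ (s + 4)) - 2 * a * b * (1 / real (Suc k) ^ (s + 2))
             + b\<^sup>2 * (1 / real (Suc k) ^ s)) = (\<lambda>k. (a / real (Suc k) ^ 2 - b)\<^sup>2 / real (Suc k) ^ s)"
    by (simp add: field_simps power_add power2_eq_square eval_nat_numeral del: of_nat_Suc)
  finally have "0 \<le> a\<^sup>2 * c - 2 * a * b * b + b\<^sup>2 * a"
    by (rule sums_le[OF _ sums_zero, rotated]) simp
  also have "\<dots> = a * (a * c - b\<^sup>2)"
    by (simp add: algebra_simps power2_eq_square)
  finally show ?thesis
    using zeta_nat_pos[OF assms] by (simp add: a_def b_def c_def zero_le_mult_iff)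
qed

section \<open>The cotangent series from the product formula for the sine\<close>

lemma sinc_pos:
  fixes x :: real
  assumes "x \<noteq> 0" "\<bar>x\<bar> < 1"
  shows "sin (pi * x) / (pi * x) > 0"
proof -
  have pos: "sin (pi * y) / (pi * y) > 0" if "0 < y" "y < 1" for y
    using that by (intro divide_pos_pos sin_gt_zero) auto
  then show ?thesis
    using pos[of x] pos[of "- x"] assms by (cases "x > 0") auto
qed

text \<open>
  The logarithm of the sine product is the sum over \<open>k\<close> of \<open>ln (1 - x\<^sup>2 / k\<^sup>2)\<close>.
  Expanding each logarithm gives a double series with terms of constant sign, and summing over \<open>k\<close>
  first produces the zeta values. The term for \<open>n = 0\<close> vanishes because of the convention \<open>y / 0 = 0\<close>.
\<close>

lemma ln_sinc_sums:
  fixes x :: real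
  assumes x: "x \<noteq> 0" "\<bar>x\<bar> < 1"
  shows "(\<lambda>n. zeta_nat (2 * n) / n * x ^ (2 * n)) sums - ln (sin (pi * x) / (pi * x))"
proof -
  define u where "u k = x\<^sup>2 / real (Suc k) ^ 2" for k
  have u: "0 \<le> u k" "u k < 1" for k
  proof -
    have "x\<^sup>2 < 1" using x by (simp add: abs_square_less_1)
    also have "1 \<le> real (Suc k) ^ 2" by (rule one_le_power) simp
    finally show "u k < 1" by (simp add: u_def)
  qed (simp add: u_def)
  have "(\<lambda>n. \<Prod>k=1..n. 1 - x\<^sup>2 / real k ^ 2) \<longlonglongrightarrow> sin (pi * x) / (pi * x)"
    using sin_product_formula_real'[OF x(1)] by simp
  also have "(\<lambda>n. \<Prod>k=1..n. 1 - x\<^sup>2 / real k ^ 2) = (\<lambda>n. \<Prod>k<n. 1 - u k)"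
    by (simp add: u_def prod.atLeast1_atMost_eq)
  finally have "(\<lambda>n. ln (\<Prod>k<n. 1 - u k)) \<longlonglongrightarrow> ln (sin (pi * x) / (pi * x))"
    using sinc_pos[OF x] by (intro tendsto_ln) auto
  also have "(\<lambda>n. ln (\<Prod>k<n. 1 - u k)) = (\<lambda>n. \<Sum>k<n. ln (1 - u k))"
    using u(2) by (subst ln_prod) (auto simp: less_imp_neq[symmetric])
  finally have "(\<lambda>k. ln (1 - u k)) sums ln (sin (pi * x) / (pi * x))"
    by (simp add: sums_def)
  then have total: "(\<lambda>k. - ln (1 - u k)) sums - ln (sin (pi * x) / (pi * x))"
    by (rule sums_minus)
  have rows: "(\<lambda>n. u k ^ n / n) sums - ln (1 - u k)" for k
    using sums_minus[OF ln_series'[of "- u k"]] u[of k] by simp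
  have cols: "(\<lambda>k. u k ^ n / n) sums (zeta_nat (2 * n) / n * x ^ (2 * n))" for n
  proof (cases "n = 0")
    case False
    have "(\<lambda>k. x ^ (2 * n) / n * (1 / real (Suc k) ^ (2 * n))) sums
            (x ^ (2 * n) / n * zeta_nat (2 * n))"
      using False by (intro sums_mult zeta_nat_sums) auto
    moreover have "u k ^ n / n = x ^ (2 * n) / n * (1 / real (Suc k) ^ (2 * n))" for k
      by (simp add: u_def power_divide power_mult del: of_nat_Suc)
    ultimately show ?thesis
      by (simp add: mult_ac)
  qed auto
  show ?thesis
    by (rule sums_swap_nonneg[OF _ rows total cols]) (simp add: u)
qed

text \<open>
  The coefficient \<open>\<zeta>(2m) / m\<close> of \<open>x\<^bsup>2m\<^esup>\<close> is written as \<open>2 \<zeta>(n) / n\<close> with \<open>n = 2m\<close>;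
  the constant coefficient is \<open>0\<close> because it is a quotient by zero.
\<close>

definition neg_ln_sinc_fps :: "real fps" where
  "neg_ln_sinc_fps = Abs_fps (\<lambda>n. if even n then 2 * zeta_nat n / n else 0)"

lemma neg_ln_sinc_fps_sums:
  fixes x :: real
  assumes x: "x \<noteq> 0" "\<bar>x\<bar> < 1"
  shows "(\<lambda>n. fps_nth neg_ln_sinc_fps n * x ^ n) sums - ln (sin (pi * x) / (pi * x))"
proof -
  have "strict_mono ((*) (2 :: nat))"
    by (auto simp: strict_mono_def)
  then show ?thesis
    using ln_sinc_sums[OF x]
    by (subst sums_mono_reindex[of "(*) 2", symmetric])
       (auto simp: neg_ln_sinc_fps_def elim!: evenE)
qed

lemma conv_radius_neg_ln_sinc_fps: "fps_conv_radius neg_ln_sinc_fps \<ge> 1"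
  unfolding fps_conv_radius_def
  by (rule conv_radius_geI_ex') (use neg_ln_sinc_fps_sums in \<open>auto simp: sums_iff one_ereal_def\<close>)

text \<open>
  Exponentiating removes the singularity of the logarithm's argument, so that the identity
  holds at \<open>x = 0\<close> as well and can be differentiated on the whole interval.
\<close>

lemma sin_eq_exp_neg_ln_sinc:
  assumes "\<bar>x\<bar> < 1"
  shows "sin (pi * x) = pi * x * exp (- eval_fps neg_ln_sinc_fps x)"
proof (cases "x = 0")
  case False
  then have "eval_fps neg_ln_sinc_fps x = - ln (sin (pi * x) / (pi * x))"
    using neg_ln_sinc_fps_sums[of x] assms by (simp add: eval_fps_def sums_iff)
  then show ?thesis
    using False sinc_pos[of x] assms by simp
qed simp

text \<open>
  Differentiating \<open>sin (\<pi> x) = \<pi> x * exp (- L x)\<close> and multiplying by \<open>x\<close> gives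
  \<open>\<pi> x * cos (\<pi> x) = sin (\<pi> x) * (1 - x * L' x)\<close> for \<open>\<bar>x\<bar> < 1\<close>, and equal functions
  have equal power series. The first factor on the left is the series
  \<open>1 - 2 (\<Sum>m\<ge>1. \<zeta>(2m) * X\<^bsup>2m\<^esup>)\<close> of \<open>\<pi> x * cot (\<pi> x)\<close>.
\<close>

lemma cot_zeta_fps:
  "(1 - fps_X * fps_deriv neg_ln_sinc_fps) * fps_sin pi = fps_const pi * fps_X * fps_cos pi"
proof -
  define L where "L = neg_ln_sinc_fps"
  have conv_L: "fps_conv_radius L \<ge> 1"
    unfolding L_def by (rule conv_radius_neg_ln_sinc_fps)
  then have conv_L': "fps_conv_radius (fps_deriv L) \<ge> 1"
    using fps_conv_radius_deriv[of L] by order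
  define Z where "Z = 1 - fps_X * fps_deriv L"
  have conv_XL': "fps_conv_radius (fps_X * fps_deriv L) \<ge> 1"
    by (rule order_trans[OF _ fps_conv_radius_mult]) (use conv_L' in simp)
  have conv_Z: "fps_conv_radius Z \<ge> 1"
    unfolding Z_def by (rule order_trans[OF _ fps_conv_radius_diff]) (use conv_XL' in simp)
  have conv_ZS: "fps_conv_radius (Z * fps_sin pi) \<ge> 1"
    by (rule order_trans[OF _ fps_conv_radius_mult]) (use conv_Z in simp)
  have conv_cX: "fps_conv_radius (fps_const pi * fps_X) \<ge> 1"
    by (rule order_trans[OF _ fps_conv_radius_mult]) simp
  have conv_XC: "fps_conv_radius (fps_const pi * fps_X * fps_cos pi) \<ge> 1"
    by (rule order_trans[OF _ fps_conv_radius_mult]) (use conv_cX in simp)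
  \<comment> \<open>All series involved converge on the unit disc, so an identity of functions there suffices.\<close>
  define D where "D = Z * fps_sin pi - fps_const pi * fps_X * fps_cos pi"
  have conv_D: "fps_conv_radius D \<ge> 1"
    unfolding D_def by (rule order_trans[OF _ fps_conv_radius_diff]) (use conv_ZS conv_XC in simp)
  have eval_D: "eval_fps D x = 0" if x: "\<bar>x\<bar> < 1" for x
  proof -
    have x': "ereal (norm x) < R" if "R \<ge> 1" for R
      using x that by (intro less_le_trans[OF _ that]) (simp add: one_ereal_def)
    have "((\<lambda>x. sin (pi * x)) has_field_derivative pi * cos (pi * x)) (at x)"
      by (auto intro!: derivative_eq_intros)
    moreover have "((\<lambda>x. sin (pi * x)) has_field_derivative
       pi * exp (- eval_fps L x) - pi * x * exp (- eval_fps L x) * eval_fps (fps_deriv L) x) (at x)"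
    proof (rule has_field_derivative_transform_within_open[where S = "ball 0 1"])
      show "((\<lambda>x. pi * x * exp (- eval_fps L x)) has_field_derivative
       pi * exp (- eval_fps L x) - pi * x * exp (- eval_fps L x) * eval_fps (fps_deriv L) x) (at x)"
        using x'[OF conv_L]
        by (auto intro!: derivative_eq_intros has_field_derivative_eval_fps simp: algebra_simps)
    qed (use x in \<open>auto simp: sin_eq_exp_neg_ln_sinc L_def\<close>)
    ultimately have "pi * cos (pi * x) =
        pi * exp (- eval_fps L x) - pi * x * exp (- eval_fps L x) * eval_fps (fps_deriv L) x"
      by (rule DERIV_unique)
    then have "pi * x * cos (pi * x) =
        pi * x * exp (- eval_fps L x) * (1 - x * eval_fps (fps_deriv L) x)"
      by algebra
    also have "pi * x * exp (- eval_fps L x) = sin (pi * x)"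
      using sin_eq_exp_neg_ln_sinc[OF x] by (simp add: L_def)
    finally have "pi * x * cos (pi * x) = sin (pi * x) * (1 - x * eval_fps (fps_deriv L) x)" .
    moreover have "eval_fps Z x = 1 - x * eval_fps (fps_deriv L) x"
      unfolding Z_def using x' conv_L' conv_XL' by (simp add: eval_fps_diff eval_fps_mult)
    moreover have "eval_fps D x = eval_fps Z x * sin (pi * x) - pi * x * cos (pi * x)"
      unfolding D_def using x' conv_Z conv_ZS conv_XC conv_cX
      by (simp add: eval_fps_diff eval_fps_mult)
    ultimately show ?thesis by simp
  qed
  have "eventually (\<lambda>x. x \<in> ball (0::real) 1) (at 0)"
    by (intro eventually_at_in_open') auto
  then have "\<forall>\<^sub>F x in at 0. eval_fps D x = 0"
    by eventually_elim (simp add: eval_D)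
  moreover have "fps_conv_radius D > 0"
    using conv_D by (rule less_le_trans[rotated]) simp
  ultimately have "D = 0"
    by (intro eval_fps_eq_0_imp_eq_0)
  then show ?thesis
    by (simp add: D_def Z_def L_def)
qed

section \<open>The cotangent series from the Bernoulli numbers\<close>

text \<open>
  The substitution \<open>x \<mapsto> c x\<close> in the exponential generating function. It multiplies the \<open>n\<close>-th
  coefficient of every factor by \<open>c ^ n\<close>, so the identity can be checked coefficientwise; this also
  moves it from the reals to the complex numbers.
\<close>

lemma bernoulli_egf_scaled:
  fixes c :: complex
  shows "Abs_fps (\<lambda>n. of_real (bernoulli n / fact n) * c ^ n) * (fps_exp c - 1) =
           fps_const c * fps_X"
proof (rule fps_ext)
  fix n
  let ?E = "Abs_fps (\<lambda>n. bernoulli n / fact n)"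
  have exp_nth: "fps_nth (fps_exp c - 1) j = c ^ j * of_real (fps_nth (fps_exp 1 - 1) j)" for j
    by (simp add: field_simps)
  have "fps_nth (Abs_fps (\<lambda>n. of_real (bernoulli n / fact n) * c ^ n) * (fps_exp c - 1)) n =
        (\<Sum>k=0..n. of_real (fps_nth ?E k) * c ^ k * (c ^ (n - k) * of_real (fps_nth (fps_exp 1 - 1) (n - k))))"
    unfolding fps_mult_nth exp_nth by simp
  also have "\<dots> = (\<Sum>k=0..n. c ^ n * of_real (fps_nth ?E k * fps_nth (fps_exp 1 - 1) (n - k)))"
  proof (rule sum.cong)
    fix k assume "k \<in> {0..n}"
    then have "c ^ n = c ^ k * c ^ (n - k)" by (simp flip: power_add)
    then show "of_real (fps_nth ?E k) * c ^ k * (c ^ (n - k) * of_real (fps_nth (fps_exp 1 - 1) (n - k))) =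
        c ^ n * of_real (fps_nth ?E k * fps_nth (fps_exp 1 - 1) (n - k))"
      by (simp only: of_real_mult mult_ac)
  qed simp
  also have "\<dots> = c ^ n * of_real (fps_nth (?E * (fps_exp 1 - 1)) n)"
    by (simp only: fps_mult_nth of_real_sum sum_distrib_left)
  also have "\<dots> = fps_nth (fps_const c * fps_X) n"
    unfolding bernoulli_egf by (cases "n = 1") simp_all
  finally show "fps_nth (Abs_fps (\<lambda>n. of_real (bernoulli n / fact n) * c ^ n) * (fps_exp c - 1)) n =
    fps_nth (fps_const c * fps_X) n" .
qed

text \<open>
  With \<open>w = exp (\<pi> \<i> x)\<close> the generating function at \<open>2 \<pi> \<i> x\<close> is \<open>2 \<pi> \<i> x / (w\<^sup>2 - 1)\<close>.
  Adding \<open>\<pi> \<i> x\<close>, which cancels the contribution of \<open>B\<^sub>1\<close>, gives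
  \<open>\<pi> \<i> x * (w + 1 / w) / (w - 1 / w)\<close>, and Euler's formulas turn this into \<open>\<pi> x * cot (\<pi> x)\<close>.
\<close>

lemma cot_bernoulli_fps:
  "(Abs_fps (\<lambda>n. of_real (bernoulli n / fact n) * (2 * pi * \<i>) ^ n) + fps_const (pi * \<i>) * fps_X)
     * fps_sin (of_real pi) = fps_const (of_real pi) * fps_X * fps_cos (of_real pi :: complex)"
proof -
  define G where "G = Abs_fps (\<lambda>n. of_real (bernoulli n / fact n) * (2 * pi * \<i>) ^ n)"
  define w w' :: "complex fps" where "w = fps_exp (\<i> * pi)" and "w' = fps_exp (- \<i> * pi)"
  define P :: "complex fps" where "P = fps_const (\<i> * pi) * fps_X"
  have ww': "w * w' = 1"
    unfolding w_def w'_def by (simp flip: fps_exp_add_mult)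
  have exp2: "fps_exp (2 * pi * \<i>) = w * w"
    unfolding w_def by (simp flip: fps_exp_add_mult add: mult_ac)
  have "fps_const (2 * pi * \<i>) * fps_X = 2 * P"
    by (rule fps_ext) (simp add: P_def numeral_fps_const mult.assoc mult.left_commute mult.commute)
  then have "G * (w * w - 1) = 2 * P"
    unfolding G_def exp2[symmetric] by (subst bernoulli_egf_scaled) 
  then have "G * (w * w - 1) * w' = 2 * P * w'"
    by simp
  also have "G * (w * w - 1) * w' = G * (w - w')"
    using ww' by algebra
  finally have "(G + P) * (w - w') = P * (w + w')"
    by algebra
  moreover have "w - w' = fps_const (2 * \<i>) * fps_sin pi"
    unfolding w_def w'_def fps_sin_fps_exp_ii by (simp add: fps_divide_unit)
  moreover have "w + w' = 2 * fps_cos pi"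
    unfolding w_def w'_def by (simp add: fps_cos_fps_exp_ii numeral_fps_const)
  moreover have "P * (2 * fps_cos pi) =
      fps_const (2 * \<i>) * (fps_const (of_real pi) * fps_X * fps_cos pi)"
    by (simp only: P_def fps_const_mult[symmetric] numeral_fps_const mult_ac)
  ultimately have "fps_const (2 * \<i>) * ((G + P) * fps_sin pi) =
      fps_const (2 * \<i>) * (fps_const (of_real pi) * fps_X * fps_cos pi)"
    by (simp only: mult.left_commute)
  then show ?thesis
    by (simp add: G_def P_def mult_ac)
qed

section \<open>Euler's formula and log-convexity of the Bernoulli numbers\<close>

text \<open>
  The two expressions for the cotangent series agree because multiplication by the sine series is
  injective. Comparing the coefficients at \<open>2n\<close> determines \<open>B\<^bsub>2n\<^esub> * (2 \<pi> \<i>)\<^bsup>2n\<^esup>\<close>, and taking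
  absolute values removes the sign \<open>\<i>\<^bsup>2n\<^esup>\<close>.
\<close>

lemma abs_bernoulli_even_eq_zeta:
  assumes "n \<ge> 1"
  shows "\<bar>bernoulli (2 * n)\<bar> = 2 * fact (2 * n) / (2 * pi) ^ (2 * n) * zeta_nat (2 * n)"
proof -
  define G :: "complex fps" where "G = Abs_fps (\<lambda>n. of_real (bernoulli n / fact n) * (2 * pi * \<i>) ^ n)"
  define Z where "Z = 1 - fps_X * fps_deriv neg_ln_sinc_fps"
  \<comment> \<open>The zeta side lives over the reals; it is transferred to the complex numbers coefficientwise.\<close>
  define Zc :: "complex fps" where "Zc = Abs_fps (\<lambda>n. of_real (fps_nth Z n))"
  have "Zc * fps_sin (of_real pi) = fps_const (of_real pi) * fps_X * fps_cos (of_real pi)"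
  proof (rule fps_ext)
    fix n
    have sin_nth: "fps_nth (fps_sin (complex_of_real pi)) k = of_real (fps_nth (fps_sin pi) k)" for k
      by (simp add: fps_sin_def)
    have cos_nth: "fps_nth (fps_cos (complex_of_real pi)) k = of_real (fps_nth (fps_cos pi) k)" for k
      by (simp add: fps_cos_def)
    have "fps_nth (Zc * fps_sin (of_real pi)) n = of_real (fps_nth (Z * fps_sin pi) n)"
      by (simp add: fps_mult_nth Zc_def sin_nth)
    also have "Z * fps_sin pi = fps_const pi * fps_X * fps_cos pi"
      unfolding Z_def by (rule cot_zeta_fps)
    also have "of_real (fps_nth (fps_const pi * fps_X * fps_cos pi) n) =
        fps_nth (fps_const (of_real pi) * fps_X * fps_cos (of_real pi) :: complex fps) n"
      by (simp add: mult.assoc cos_nth)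
    finally show "fps_nth (Zc * fps_sin (of_real pi)) n =
        fps_nth (fps_const (of_real pi) * fps_X * fps_cos (of_real pi)) n" .
  qed
  then have "(G + fps_const (pi * \<i>) * fps_X) * fps_sin (of_real pi) = Zc * fps_sin (of_real pi)"
    unfolding G_def cot_bernoulli_fps by simp
  moreover have "fps_nth (fps_sin (complex_of_real pi)) 1 \<noteq> 0"
    by simp
  then have "fps_sin (complex_of_real pi) \<noteq> 0"
    by (metis fps_zero_nth)
  ultimately have "G + fps_const (pi * \<i>) * fps_X = Zc"
    by simp
  then have "fps_nth (G + fps_const (pi * \<i>) * fps_X) (2 * n) = fps_nth Zc (2 * n)"
    by simp
  moreover have "fps_nth Z (2 * n) = - 2 * zeta_nat (2 * n)"
    using assms by (simp add: Z_def neg_ln_sinc_fps_def)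
  ultimately have "of_real (bernoulli (2 * n) / fact (2 * n)) * (2 * pi * \<i>) ^ (2 * n) =
      complex_of_real (- 2 * zeta_nat (2 * n))"
    using assms by (simp add: G_def Zc_def)
  then have "cmod (of_real (bernoulli (2 * n) / fact (2 * n)) * (2 * pi * \<i>) ^ (2 * n)) =
      cmod (of_real (- 2 * zeta_nat (2 * n)))"
    by (rule arg_cong)
  then have "\<bar>bernoulli (2 * n)\<bar> / fact (2 * n) * (2 * pi) ^ (2 * n) = 2 * zeta_nat (2 * n)"
    using zeta_nat_pos[of "2 * n"] assms
    by (simp only: norm_mult norm_power norm_of_real norm_ii) (simp add: abs_mult)
  then show ?thesis
    by (simp add: field_simps)
qed

lemma abs_bernoulli_even_pos: "n \<ge> 1 \<Longrightarrow> \<bar>bernoulli (2 * n)\<bar> > 0"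
  by (simp only: abs_bernoulli_even_eq_zeta) (simp add: zeta_nat_pos)

text \<open>
  In Euler's formula the quotients of consecutive factorials are \<open>u = (2n + 1) * (2n + 2)\<close> and
  \<open>v = (2n + 3) * (2n + 4)\<close>, the powers of \<open>2 \<pi>\<close> cancel, and the claim becomes the product of
  \<open>u \<le> v\<close> and the log-convexity of the zeta values.
\<close>

lemma abs_bernoulli_even_log_convex:
  assumes "n \<ge> 1"
  shows "\<bar>bernoulli (2 * (n + 1))\<bar>\<^sup>2 \<le> \<bar>bernoulli (2 * n)\<bar> * \<bar>bernoulli (2 * (n + 2))\<bar>"
proof -
  define r where "r = 2 * fact (2 * n) / (2 * pi) ^ (2 * n)"
  define u v where "u = real ((2 * n + 1) * (2 * n + 2))" and "v = real ((2 * n + 3) * (2 * n + 4))"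
  define z where "z = (\<lambda>k. zeta_nat (2 * n + k))"
  have pos: "0 < r" "0 < u" "u \<le> v"
    unfolding u_def v_def of_nat_le_iff of_nat_0_less_iff
    by (simp_all add: r_def mult_le_mono del: mult_Suc mult_Suc_right)
  have b0: "\<bar>bernoulli (2 * n)\<bar> = r * z 0"
    using assms by (subst abs_bernoulli_even_eq_zeta) (auto simp: r_def z_def)
  have b1: "\<bar>bernoulli (2 * (n + 1))\<bar> = r * u / (2 * pi) ^ 2 * z 2"
    using assms by (subst abs_bernoulli_even_eq_zeta)
      (auto simp: r_def z_def u_def field_simps power_add eval_nat_numeral)
  have b2: "\<bar>bernoulli (2 * (n + 2))\<bar> = r * u * v / (2 * pi) ^ 4 * z 4"
    using assms by (subst abs_bernoulli_even_eq_zeta)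
      (auto simp: r_def z_def u_def v_def field_simps power_add eval_nat_numeral)
  have "u * u * (z 2)\<^sup>2 \<le> u * v * (z 0 * z 4)"
    using pos zeta_nat_log_convex[of "2 * n"] assms
    by (intro mult_mono) (auto simp: z_def)
  then have "r\<^sup>2 / (2 * pi) ^ 4 * (u * u * (z 2)\<^sup>2) \<le> r\<^sup>2 / (2 * pi) ^ 4 * (u * v * (z 0 * z 4))"
    by (intro mult_left_mono) auto
  then show ?thesis
    unfolding b0 b1 b2 by (simp add: power_mult_distrib power_divide mult_ac eval_nat_numeral)
qed

lemma bernoulli_4: "bernoulli 4 = - 1 / 30"
proof -
  have "bernoulli 3 = 0"
    using bernoulli_recurrence[of 3] bernoulli_small by (simp add: eval_nat_numeral)
  then show ?thesis
    using bernoulli_recurrence[of 4] bernoulli_small by (simp add: eval_nat_numeral)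
qed

section \<open>Roots of log-convex sequences\<close>

text \<open>
  After raising to the power \<open>n * (n + 1)\<close> the claim is \<open>b n ^ (n + 1) < b (n + 1) ^ n\<close>. Its induction
  step raises the convexity inequality to the power \<open>n + 1\<close>, applies the induction hypothesis
  to the factor \<open>b n ^ (n + 1)\<close>, and cancels \<open>b (n + 1) ^ n\<close>.
\<close>

lemma root_less_root_Suc_of_log_convex:
  fixes b :: "nat \<Rightarrow> real"
  assumes pos: "\<And>n. n \<ge> 1 \<Longrightarrow> b n > 0"
    and convex: "\<And>n. n \<ge> 1 \<Longrightarrow> (b (n + 1))\<^sup>2 \<le> b n * b (n + 2)"
    and start: "(b 1)\<^sup>2 < b 2"
    and n: "n \<ge> 1"
  shows "root n (b n) < root (n + 1) (b (n + 1))"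
proof -
  have "b n ^ (n + 1) < b (n + 1) ^ n"
    using n
  proof (induction n rule: dec_induct)
    case base
    then show ?case using start by (simp add: numeral_2_eq_2)
  next
    case (step n)
    have "b (n + 1) ^ n * b (n + 1) ^ (n + 2) = ((b (n + 1))\<^sup>2) ^ (n + 1)"
      by (simp add: mult_2 flip: power_add power_mult)
    also have "\<dots> \<le> (b n * b (n + 2)) ^ (n + 1)"
      using step.hyps by (intro power_mono convex) auto
    also have "\<dots> = b n ^ (n + 1) * b (n + 2) ^ (n + 1)"
      by (simp add: power_mult_distrib)
    also have "\<dots> < b (n + 1) ^ n * b (n + 2) ^ (n + 1)"
      using step.IH step.hyps by (intro mult_strict_right_mono zero_less_power pos) auto
    finally show ?case
      using pos[of "n + 1"] by simp
  qed
  then have "root (n * (n + 1)) (b n ^ (n + 1)) < root (n * (n + 1)) (b (n + 1) ^ n)"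
    using n by simp
  moreover have "root (n * (n + 1)) (b n ^ (n + 1)) = root n (b n)"
    using pos[OF n] by (simp only: real_root_mult_exp) (simp add: real_root_power_cancel del: power_Suc)
  moreover have "root (n * (n + 1)) (b (n + 1) ^ n) = root (n + 1) (b (n + 1))"
    using n pos[of "n + 1"]
    by (simp only: mult.commute[of n] real_root_mult_exp) (simp add: real_root_power_cancel)
  ultimately show ?thesis
    by simp
qed

theorem corollary3p2:
  shows "strict_mono_on {1..} (\<lambda>n::nat. root n \<bar>bernoulli (2 * n)\<bar>) \<and>
         (\<forall>n::nat\<ge>1. root n \<bar>bernoulli (2 * n)\<bar> < root (n + 1) \<bar>bernoulli (2 * n + 2)\<bar>)"
proof -
  define f where "f n = root n \<bar>bernoulli (2 * n)\<bar>" for n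
  have step: "f n < f (n + 1)" if "n \<ge> 1" for n
    unfolding f_def
  proof (rule root_less_root_Suc_of_log_convex[OF _ _ _ that])
    show "\<bar>bernoulli (2 * 1)\<bar>\<^sup>2 < \<bar>bernoulli (2 * 2)\<bar>"
      by (simp add: bernoulli_small(3) bernoulli_4 power2_eq_square)
  qed (use abs_bernoulli_even_pos abs_bernoulli_even_log_convex in blast)+
  have "f m < f n" if "1 \<le> m" "m < n" for m n
    using that(2,1) by (induction rule: less_Suc_induct) (use step in auto)
  then have "strict_mono_on {1..} f"
    by (auto intro: strict_mono_onI)
  with step show ?thesis
    by (simp add: f_def[abs_def])
qed

end
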